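(* Let $\mathcal{A}=\{L_0,L_1,\dots,L_n\}$ be a line arrangement in $\mathbb{P}^2$ with complement $M=\mathbb{P}^2\setminus(L_0\cup\dots\cup L_n)$. If $\mathcal{A}$ is in the class $\mathcal{C}_k$ for some $k\le 2$ (i.e. $k\in\{0,1,2\}$), then every rank one local system $\mathcal{L}\in\mathbb{T}(M)$ on $M$ is admissible.
   Context: A line arrangement is a finite nonempty set $\mathcal{A}=\{L_0,\dots,L_n\}$ of distinct lines in the complex projective plane $\mathbb{P}^2$. The multiplicity of a point is the number of lines of $\mathcal{A}$ passing through it. The arrangement $\mathcal{A}$ is of type (in the class) $\mathcal{C}_k$ if $k\ge 0$ is the minimal number of lines in $\mathcal{A}$ whose union contains all the points of multiplicity at least 3 (so $k=0$ means there are no such points). $\mathbb{T}(M)=\mathrm{Hom}(\pi_1(M),\mathbb{C}^* )$ is the character group of $M$, identified with the set of rank one complex local systems on $M$. A rank one local system $\mathcal{L}\in\mathbb{T}(M)$ is the same as a choice of monodromies $\lambda_j\in\mathbb{C}^*$ around $L_j$, $0\le j\le n$, with $\lambda_0\cdots\lambda_n=1$. A class $\alpha\in H^1(M,\mathbb{C})$ is given by $\alpha=\sum_{j=0}^n a_j\,\frac{df_j}{f_j}$, where $f_j=0$ is a linear equation of $L_j$ and the residues $a_j\in\mathbb{C}$ satisfy $\sum_{j=0}^n a_j=0$. The map $\exp:H^1(M,\mathbb{C})\to\mathbb{T}(M)$ is induced by $t\mapsto\exp(2\pi i t)$, so that $\exp(\alpha)=\mathcal{L}$ if and only if $\lambda_j=\exp(2\pi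 i a_j)$ for all $j=0,\dots,n$. The local system $\mathcal{L}$ is admissible if there is a class $\alpha=\sum_{j=0}^n a_j\,\frac{df_j}{f_j}\in H^1(M,\mathbb{C})$, with residues $a_j\in\mathbb{C}$ satisfying $\sum_{j=0}^n a_j=0$, such that $\exp(\alpha)=\mathcal{L}$, $a_j\notin\mathbb{Z}_{>0}$ for all $j=0,\dots,n$, and for any point $p\in L_0\cup\dots\cup L_n$ of multiplicity at least 3 one has $a(p)=\sum_{j:\,p\in L_j}a_j\notin\mathbb{Z}_{>0}$. *)

theory Defs
  imports "HOL-Analysis.Analysis"
begin

text \<open>The complex projective plane: a point is a one-dimensional complex linear subspace of
  \<open>\<complex>\<^sup>3\<close>.  The constants \<open>vec.subspace\<close> and \<open>vec.dim\<close> refer to the scalar multiplication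
  \<open>*s\<close> by complex numbers, unlike \<open>subspace\<close> and \<open>dim\<close>, which are over the reals.\<close>

type_synonym proj_point = "(complex ^ 3) set"

definition P2 :: "proj_point set" where
  "P2 = {p. vec.subspace p \<and> vec.dim p = 1}"

definition zero_locus :: "complex ^ 3 \<Rightarrow> proj_point set" where
  "zero_locus c = {p \<in> P2. \<forall>v\<in>p. (\<Sum>i\<in>UNIV. c $ i * v $ i) = 0}"

definition proj_lines :: "proj_point set set" where
  "proj_lines = {zero_locus c | c. c \<noteq> 0}"

definition line_arrangement :: "proj_point set set \<Rightarrow> bool" where
  "line_arrangement \<A> \<longleftrightarrow> finite \<A> \<and> \<A> \<noteq> {} \<and> \<A> \<subseteq> proj_lines"

definition multiplicity_at :: "proj_point set set \<Rightarrow> proj_point \<Rightarrow> nat" where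
  "multiplicity_at \<A> p = card {L \<in> \<A>. p \<in> L}"

definition multiple_points :: "proj_point set set \<Rightarrow> proj_point set" where
  "multiple_points \<A> = {p \<in> P2. multiplicity_at \<A> p \<ge> 3}"

definition in_class_C :: "nat \<Rightarrow> proj_point set set \<Rightarrow> bool" where
  "in_class_C k \<A> \<longleftrightarrow>
     (\<exists>\<B>\<subseteq>\<A>. card \<B> = k \<and> multiple_points \<A> \<subseteq> \<Union>\<B>) \<and>
     (\<forall>\<B>\<subseteq>\<A>. multiple_points \<A> \<subseteq> \<Union>\<B> \<longrightarrow> k \<le> card \<B>)"

text \<open>Let \<open>M\<close> be the complement of the arrangement.  The meridians of the lines generate \<open>H\<^sub>1(M)\<close>,
  with the single relation that their sum vanishes, so a rank one local system on \<open>M\<close>, that is, a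
  character of \<open>\<pi>\<^sub>1(M)\<close>, is recorded by its monodromies around the lines.  Likewise a class
  \<open>\<Sum>\<^sub>L a\<^sub>L df\<^sub>L / f\<^sub>L\<close> in \<open>H\<^sup>1(M, \<complex>)\<close> is recorded by its residues \<open>a\<^sub>L\<close>.  Both are functions on the
  lines of \<open>\<A>\<close>, made \<open>undefined\<close> outside \<open>\<A>\<close> by \<open>\<rightarrow>\<^sub>E\<close>.\<close>

definition local_systems :: "proj_point set set \<Rightarrow> (proj_point set \<Rightarrow> complex) set" where
  "local_systems \<A> = {l \<in> \<A> \<rightarrow>\<^sub>E (UNIV - {0}). (\<Prod>L\<in>\<A>. l L) = 1}"

definition cohomology_classes :: "proj_point set set \<Rightarrow> (proj_point set \<Rightarrow> complex) set" where
  "cohomology_classes \<A> = {a \<in> \<A> \<rightarrow>\<^sub>E UNIV. (\<Sum>L\<in>\<A>. a L) = 0}"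

definition exp_class ::
    "proj_point set set \<Rightarrow> (proj_point set \<Rightarrow> complex) \<Rightarrow> proj_point set \<Rightarrow> complex" where
  "exp_class \<A> a = (\<lambda>L\<in>\<A>. exp (2 * of_real pi * \<i> * a L))"

definition residue_at ::
    "proj_point set set \<Rightarrow> (proj_point set \<Rightarrow> complex) \<Rightarrow> proj_point \<Rightarrow> complex" where
  "residue_at \<A> a p = (\<Sum>L\<in>{L \<in> \<A>. p \<in> L}. a L)"

definition pos_ints :: "complex set" where
  "pos_ints = {of_int m | m. m > 0}"

definition admissible :: "proj_point set set \<Rightarrow> (proj_point set \<Rightarrow> complex) \<Rightarrow> bool" where
  "admissible \<A> \<L> \<longleftrightarrow>
     (\<exists>a\<in>cohomology_classes \<A>. exp_class \<A> a = \<L> \<and>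
        (\<forall>L\<in>\<A>. a L \<notin> pos_ints) \<and>
        (\<forall>p\<in>\<Union>\<A>. multiplicity_at \<A> p \<ge> 3 \<longrightarrow> residue_at \<A> a p \<notin> pos_ints))"

end

theory Submission
  imports Defs
begin

text \<open>Choose logarithms \<open>b\<^sub>L\<close> of the monodromies with real parts in \<open>[0, 1)\<close>, and let \<open>L\<^sub>0, L\<^sub>1\<close> be lines
  of the arrangement containing all multiple points.  Keep \<open>b\<close> on the other lines, with total
  \<open>S\<close>, and choose residues with \<open>a\<^sub>0 + a\<^sub>1 = - S\<close>.  At \<open>L\<^sub>0 \<inter> L\<^sub>1\<close> the residue has real part at most
  \<open>0\<close>.  For a point \<open>p\<close> of \<open>L\<^sub>0\<close> off \<open>L\<^sub>1\<close> let \<open>X\<close> be the set of other lines through it, and similarly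
  \<open>Y\<close> for a point of \<open>L\<^sub>1\<close> off \<open>L\<^sub>0\<close>; the empty set plays the same role for the conditions on \<open>a\<^sub>0\<close>
  and \<open>a\<^sub>1\<close> themselves.  Among the \<open>X\<close> whose residue is integral take one with \<open>Re b(X)\<close> maximal
  and put \<open>a\<^sub>0 = - b(X)\<close>.  The residue for \<open>Y\<close> is then
  \<open>b(X) + b(Y) - S = b(X \<inter> Y) - b(complement of X \<union> Y)\<close>.  As two points lie on only one common
  line, \<open>X \<inter> Y\<close> has at most one element, so the real part is less than \<open>1\<close>.
  If no \<open>X\<close> has integral residue, it suffices to give \<open>a\<^sub>1\<close> a very negative real part.\<close>

subsection \<open>Points and lines of the projective plane\<close>

lemma P2_generator:
  assumes "p \<in> P2"
  obtains v where "v \<noteq> 0" "p = vec.span {v}"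
proof -
  have sub: "vec.subspace p" and dim: "vec.dim p = 1"
    using assms by (auto simp: P2_def)
  obtain B where B: "B \<subseteq> p" "vec.independent B" "p \<subseteq> vec.span B" "card B = vec.dim p"
    using vec.basis_exists by blast
  obtain v where v: "B = {v}"
    using B(4) dim by (auto simp: card_1_singleton_iff)
  have "v \<noteq> 0"
    using B(2) v vec.dependent_zero by auto
  moreover have "p = vec.span {v}"
    using B v sub vec.span_minimal by blast
  ultimately show thesis
    using that by blast
qed

text \<open>A point of \<open>P2\<close> is spanned by any nonzero vector it contains, so two points
  sharing such a vector coincide.\<close>

lemma P2_eqI:
  assumes "p \<in> P2" "q \<in> P2" "v \<in> p" "v \<in> q" "v \<noteq> 0"
  shows "p = q"
proof -
  have *: "r = vec.span {v}" if r: "r \<in> P2" and v: "v \<in> r" for r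
  proof -
    obtain w where w: "r = vec.span {w}"
      using P2_generator[OF r] by blast
    then obtain c where c: "v = c *s w"
      using v by (auto simp: vec.span_singleton)
    with \<open>v \<noteq> 0\<close> have "w = inverse c *s v"
      by auto
    then show ?thesis
      using c w by (metis vec.span_base vec.span_eq vec.span_scale empty_subsetI insert_subset
          singletonI)
  qed
  show ?thesis
    using *[of p] *[of q] assms by simp
qed

text \<open>A linear form vanishing at two distinct points is a nonzero multiple of the cross
  product of vectors spanning them, so it has the same zeros.\<close>

lemma zero_locus_unique:
  assumes pq: "p \<noteq> q"
    and c: "c \<noteq> 0" "p \<in> zero_locus c" "q \<in> zero_locus c"
    and d: "d \<noteq> 0" "p \<in> zero_locus d" "q \<in> zero_locus d"
  shows "zero_locus c = zero_locus d"
proof -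
  have P2: "p \<in> P2" "q \<in> P2"
    using c by (auto simp: zero_locus_def)
  obtain v where v: "v \<noteq> 0" "p = vec.span {v}"
    using P2_generator P2 by blast
  obtain w where w: "w \<noteq> 0" "q = vec.span {w}"
    using P2_generator P2 by blast
  have vp: "v \<in> p" and wq: "w \<in> q"
    using v w vec.span_base by auto
  \<comment> \<open>The cross product of \<open>v\<close> and \<open>w\<close>; it vanishes only if
    they are proportional, which would make the points equal.\<close>
  define e where "e = (vector [v$2*w$3 - v$3*w$2, v$3*w$1 - v$1*w$3, v$1*w$2 - v$2*w$1] :: complex^3)"
  have e: "e$1 = v$2*w$3 - v$3*w$2" "e$2 = v$3*w$1 - v$1*w$3" "e$3 = v$1*w$2 - v$2*w$1"
    by (simp_all add: e_def)
  have e0: "e \<noteq> 0"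
  proof
    assume "e = 0"
    then have z: "v$2*w$3 = v$3*w$2" "v$3*w$1 = v$1*w$3" "v$1*w$2 = v$2*w$1"
      using e by auto
    obtain i where i: "w $ i \<noteq> 0"
      using w(1) by (auto simp: vec_eq_iff)
    have "\<forall>j. w$i * v$j = v$i * w$j"
      using exhaust_3[of i] z by (auto simp: forall_3 mult.commute)
    then have "v = (v$i / w$i) *s w"
      using i by (auto simp: vec_eq_iff field_simps)
    then have "v \<in> q"
      using w(2) by (metis vec.span_base vec.span_scale singletonI)
    then show False
      using P2_eqI[OF P2 vp] v(1) pq by blast
  qed
  have *: "zero_locus c = zero_locus e" if c: "c \<noteq> 0" "p \<in> zero_locus c" "q \<in> zero_locus c" for c
  proof -
    have cv: "c$1 * v$1 + c$2 * v$2 + c$3 * v$3 = 0" and cw: "c$1 * w$1 + c$2 * w$2 + c$3 * w$3 = 0"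
      using c vp wq by (auto simp: zero_locus_def sum_3)
    \<comment> \<open>These say that the cross product of \<open>c\<close> and \<open>e\<close> is
      zero: it equals (c.w) v - (c.v) w, and both coefficients vanish.\<close>
    have "c$1*e$2 = c$2*e$1" "c$1*e$3 = c$3*e$1" "c$2*e$3 = c$3*e$2"
      using cv cw unfolding e by algebra+
    then have ce: "c$i * e$j = c$j * e$i" for i j
      using exhaust_3[of i] exhaust_3[of j] by auto
    obtain i where i: "e $ i \<noteq> 0"
      using e0 by (auto simp: vec_eq_iff)
    define k where "k = c$i / e$i"
    have c_eq: "c$j = k * e$j" for j
      using ce[of i j] i by (simp add: k_def field_simps)
    have "k \<noteq> 0"
      using c(1) c_eq by (auto simp: vec_eq_iff)
    moreover have "(\<Sum>j\<in>UNIV. c$j * x$j) = k * (\<Sum>j\<in>UNIV. e$j * x$j)" for x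
      by (simp add: c_eq sum_distrib_left mult.assoc)
    ultimately have "(\<Sum>j\<in>UNIV. c$j * x$j) = 0 \<longleftrightarrow> (\<Sum>j\<in>UNIV. e$j * x$j) = 0" for x
      by simp
    then show ?thesis
      by (simp add: zero_locus_def)
  qed
  show ?thesis
    using *[OF c] *[OF d] by simp
qed

lemma proj_lines_eqI:
  assumes "L \<in> proj_lines" "K \<in> proj_lines" "p \<noteq> q" "p \<in> L" "q \<in> L" "p \<in> K" "q \<in> K"
  shows "L = K"
proof -
  obtain c d where "c \<noteq> 0" "L = zero_locus c" "d \<noteq> 0" "K = zero_locus d"
    using assms(1,2) by (auto simp: proj_lines_def)
  then show ?thesis
    using assms zero_locus_unique[of p q c d] by simp
qed

subsection \<open>Choice of the residues\<close>

lemma exp_2pi_ii_eq_1_iff: "exp (2 * of_real pi * \<i> * z) = 1 \<longleftrightarrow> z \<in> \<int>"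
proof -
  have "exp (2 * of_real pi * \<i> * z) = 1 \<longleftrightarrow> Im z = 0 \<and> (\<exists>n::int. Re z = of_int n)"
    by (auto simp: exp_eq_1)
  also have "\<dots> \<longleftrightarrow> z \<in> \<int>"
    by (auto simp: Ints_def complex_eq_iff image_iff)
  finally show ?thesis .
qed

lemma exp_2pi_ii_cong:
  assumes "z - w \<in> \<int>"
  shows "exp (2 * of_real pi * \<i> * z) = exp (2 * of_real pi * \<i> * w)"
proof -
  have "exp (2 * of_real pi * \<i> * z) = exp (2 * of_real pi * \<i> * (z - w)) * exp (2 * of_real pi * \<i> * w)"
    by (simp flip: exp_add add: algebra_simps)
  then show ?thesis
    using assms exp_2pi_ii_eq_1_iff by simp
qed

lemma exists_log_2pi_ii:
  assumes "x \<noteq> 0"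
  shows "\<exists>b. exp (2 * of_real pi * \<i> * b) = x \<and> 0 \<le> Re b \<and> Re b < 1"
proof -
  define z where "z = Ln x / (2 * of_real pi * \<i>)"
  define b where "b = z - of_int \<lfloor>Re z\<rfloor>"
  have "exp (2 * of_real pi * \<i> * b) = exp (2 * of_real pi * \<i> * z)"
    by (rule exp_2pi_ii_cong) (simp add: b_def)
  also have "\<dots> = x"
    using assms by (simp add: z_def)
  finally show ?thesis
    by (intro exI[of _ b]) (auto simp: b_def, linarith)
qed

lemma Re_lt_1_imp_notin_pos_ints: "Re z < 1 \<Longrightarrow> z \<notin> pos_ints"
  by (auto simp: pos_ints_def)

lemma notin_Ints_imp_notin_pos_ints: "z \<notin> \<int> \<Longrightarrow> z \<notin> pos_ints"
  by (auto simp: pos_ints_def)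

text \<open>Combinatorial core of the case of two lines: \<open>\<alpha>\<close> and
  \<open>\<beta>\<close> are logarithms at these lines, \<open>A\<close> is the set of other lines,
  and \<open>F\<close>, \<open>G\<close> contain the sets of other lines through points of exactly
  one of the two. Residues may move only by integers, and \<open>int\<close> makes the two
  congruences compatible with the prescribed sum.\<close>

lemma exists_residue_pair:
  fixes b :: "'a \<Rightarrow> complex" and \<alpha> \<beta> :: complex
  assumes fin: "finite A"
    and b: "\<And>x. x \<in> A \<Longrightarrow> 0 \<le> Re (b x) \<and> Re (b x) < 1"
    and int: "\<alpha> + \<beta> + sum b A \<in> \<int>"
    and F: "\<And>X. X \<in> F \<Longrightarrow> X \<subseteq> A" and G: "\<And>Y. Y \<in> G \<Longrightarrow> Y \<subseteq> A"
    and FG: "\<And>X Y. X \<in> F \<Longrightarrow> Y \<in> G \<Longrightarrow> card (X \<inter> Y) \<le> 1"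
  obtains a0 a1 where "a0 - \<alpha> \<in> \<int>" "a1 - \<beta> \<in> \<int>" "a0 + a1 = - sum b A"
    "\<And>X. X \<in> F \<Longrightarrow> a0 + sum b X \<notin> pos_ints" "\<And>Y. Y \<in> G \<Longrightarrow> a1 + sum b Y \<notin> pos_ints"
proof -
  define R where "R = {X \<in> F. \<alpha> + sum b X \<in> \<int>}"
  have "finite R"
    using fin F by (auto simp: R_def intro: finite_subset[of _ "Pow A"])
  show thesis
  proof (cases "R = {}")
    case True
    \<comment> \<open>With this shift \<open>a1 + sum b A\<close> has real part at most 0, and
      subsets of \<open>A\<close> have no larger real part.\<close>
    define m where "m = \<lceil>Re \<beta> + Re (sum b A)\<rceil>"
    define a1 where "a1 = \<beta> - of_int m"
    have a0: "(- sum b A - a1) - \<alpha> \<in> \<int>"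
    proof -
      have "(- sum b A - a1) - \<alpha> = of_int m - (\<alpha> + \<beta> + sum b A)"
        by (simp add: a1_def)
      then show ?thesis
        using int by (metis Ints_diff Ints_of_int)
    qed
    show thesis
    proof (rule that[OF a0, of a1])
      fix X assume X: "X \<in> F"
      \<comment> \<open>Modulo integers this is \<open>\<alpha> + sum b X\<close>, never integral
        when \<open>R\<close> is empty.\<close>
      have "(- sum b A - a1) + sum b X \<notin> \<int>"
      proof
        assume "(- sum b A - a1) + sum b X \<in> \<int>"
        then have "((- sum b A - a1) + sum b X) - ((- sum b A - a1) - \<alpha>) \<in> \<int>"
          using a0 Ints_diff by blast
        then have "X \<in> R"
          using X by (simp add: R_def algebra_simps)
        then show False
          using True by blast
      qed
      then show "(- sum b A - a1) + sum b X \<notin> pos_ints"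
        by (rule notin_Ints_imp_notin_pos_ints)
    next
      fix Y assume "Y \<in> G"
      then have "Re (sum b Y) \<le> Re (sum b A)"
        using G b fin by (auto intro!: sum_mono2)
      then show "a1 + sum b Y \<notin> pos_ints"
        by (intro Re_lt_1_imp_notin_pos_ints) (simp add: a1_def m_def, linarith)
    qed (simp_all add: a1_def)
  next
    case False
    obtain X where X: "X \<in> R" and max: "\<And>X'. X' \<in> R \<Longrightarrow> Re (sum b X') \<le> Re (sum b X)"
    proof -
      have "Max ((\<lambda>X. Re (sum b X)) ` R) \<in> (\<lambda>X. Re (sum b X)) ` R"
        using False \<open>finite R\<close> by (intro Max_in) auto
      then show ?thesis
        using that Max_ge[of "(\<lambda>X. Re (sum b X)) ` R"] \<open>finite R\<close> by (smt (verit) finite_imageI imageE imageI)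
    qed
    have XF: "X \<in> F" and X_int: "\<alpha> + sum b X \<in> \<int>"
      using X by (auto simp: R_def)
    have finX: "finite X"
      using F[OF XF] fin finite_subset by blast
    show thesis
    proof (rule that[of "- sum b X" "sum b X - sum b A"])
      have "- sum b X - \<alpha> = - (\<alpha> + sum b X)"
        by simp
      then show "- sum b X - \<alpha> \<in> \<int>"
        using X_int by (metis Ints_minus)
      have "sum b X - sum b A - \<beta> = (\<alpha> + sum b X) - (\<alpha> + \<beta> + sum b A)"
        by simp
      then show "sum b X - sum b A - \<beta> \<in> \<int>"
        using X_int int by (metis Ints_diff)
    next
      fix X' assume X': "X' \<in> F"
      show "- sum b X + sum b X' \<notin> pos_ints"
      \<comment> \<open>For members of \<open>R\<close>, maximality gives real part at most 0; for
        the others the value is not even an integer.\<close>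
      proof (cases "X' \<in> R")
        case True
        then show ?thesis
          using max by (intro Re_lt_1_imp_notin_pos_ints) (fastforce)
      next
        case False
        have "- sum b X + sum b X' \<notin> \<int>"
        proof
          assume "- sum b X + sum b X' \<in> \<int>"
          then have "(\<alpha> + sum b X) + (- sum b X + sum b X') \<in> \<int>"
            using X_int Ints_add by blast
          then show False
            using False X' by (simp add: R_def)
        qed
        then show ?thesis
          by (rule notin_Ints_imp_notin_pos_ints)
      qed
    next
      fix Y assume Y: "Y \<in> G"
      have finY: "finite Y"
        using G[OF Y] fin finite_subset by blast
      have "sum b A = sum b (X \<union> Y) + sum b (A - (X \<union> Y))"
        using F[OF XF] G[OF Y] fin by (metis Un_least add.commute sum.subset_diff)
      moreover have "sum b (X \<union> Y) + sum b (X \<inter> Y) = sum b X + sum b Y"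
        using finX finY by (rule sum.union_inter)
      ultimately have eq: "sum b X - sum b A + sum b Y = sum b (X \<inter> Y) - sum b (A - (X \<union> Y))"
        by (simp add: algebra_simps)
      have "Re (sum b (X \<inter> Y)) < 1"
      proof (cases "X \<inter> Y = {}")
        case False
        then obtain x where "X \<inter> Y = {x}"
          using FG[OF XF Y] finX by (metis One_nat_def card_1_singletonE card_gt_0_iff finite_Int
              le_antisym less_eq_Suc_le)
        then show ?thesis
          using b F[OF XF] by auto
      qed simp
      moreover have "0 \<le> Re (sum b (A - (X \<union> Y)))"
        using b by (auto intro!: sum_nonneg)
      ultimately show "sum b X - sum b A + sum b Y \<notin> pos_ints"
        unfolding eq by (intro Re_lt_1_imp_notin_pos_ints) simp
    qed simp
  qed
qed

subsection \<open>Admissibility\<close>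

text \<open>Lets \<open>a\<close> be arbitrary off \<A>; restricting it gives the extensional
  function that \<open>cohomology_classes\<close> demands.\<close>

lemma admissibleI:
  assumes \<L>: "\<L> \<in> local_systems \<A>"
    and exp: "\<And>L. L \<in> \<A> \<Longrightarrow> exp (2 * of_real pi * \<i> * a L) = \<L> L"
    and sum: "sum a \<A> = 0"
    and line: "\<And>L. L \<in> \<A> \<Longrightarrow> a L \<notin> pos_ints"
    and point: "\<And>p. p \<in> \<Union>\<A> \<Longrightarrow> multiplicity_at \<A> p \<ge> 3 \<Longrightarrow> residue_at \<A> a p \<notin> pos_ints"
  shows "admissible \<A> \<L>"
  unfolding admissible_def
proof (intro bexI[of _ "restrict a \<A>"] conjI ballI impI)
  show "exp_class \<A> (restrict a \<A>) = \<L>"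
    using \<L> exp by (auto simp: exp_class_def local_systems_def fun_eq_iff PiE_def extensional_def)
  show "restrict a \<A> \<in> cohomology_classes \<A>"
    using sum by (auto simp: cohomology_classes_def cong: sum.cong)
next
  fix p assume "p \<in> \<Union>\<A>" "3 \<le> multiplicity_at \<A> p"
  moreover have "residue_at \<A> (restrict a \<A>) p = residue_at \<A> a p"
    by (simp add: residue_at_def)
  ultimately show "residue_at \<A> (restrict a \<A>) p \<notin> pos_ints"
    using point by simp
qed (use line in simp)

text \<open>The monodromies multiply to 1, so the normalised logarithms sum to an integer, in
  general nonzero; this is what the later choices correct.\<close>

lemma local_system_logarithm:
  assumes fin: "finite \<A>" and \<L>: "\<L> \<in> local_systems \<A>"
  obtains b where "\<And>L. L \<in> \<A> \<Longrightarrow> exp (2 * of_real pi * \<i> * b L) = \<L> L"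
    "\<And>L. L \<in> \<A> \<Longrightarrow> 0 \<le> Re (b L) \<and> Re (b L) < 1" "sum b \<A> \<in> \<int>"
proof -
  have "\<forall>L\<in>\<A>. \<exists>b. exp (2 * of_real pi * \<i> * b) = \<L> L \<and> 0 \<le> Re b \<and> Re b < 1"
    using \<L> exists_log_2pi_ii by (auto simp: local_systems_def PiE_iff)
  then obtain b where b: "\<And>L. L \<in> \<A> \<Longrightarrow> exp (2 * of_real pi * \<i> * b L) = \<L> L \<and> 0 \<le> Re (b L) \<and> Re (b L) < 1"
    by metis
  have "exp (2 * of_real pi * \<i> * sum b \<A>) = (\<Prod>L\<in>\<A>. \<L> L)"
    using b fin by (simp add: sum_distrib_left exp_sum)
  also have "\<dots> = 1"
    using \<L> by (simp add: local_systems_def)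
  finally have "sum b \<A> \<in> \<int>"
    by (simp add: exp_2pi_ii_eq_1_iff)
  then show thesis
    using that b by blast
qed

text \<open>\<open>L0\<close> absorbs the whole correction. At a point of \<open>L0\<close> the
  residue is then minus the sum of \<open>b\<close> over the lines missing the point, so its real
  part is at most 0.\<close>

lemma admissible_one_line:
  assumes fin: "finite \<A>" and L0: "L0 \<in> \<A>"
    and cover: "\<And>p. p \<in> \<Union>\<A> \<Longrightarrow> multiplicity_at \<A> p \<ge> 3 \<Longrightarrow> p \<in> L0"
    and \<L>: "\<L> \<in> local_systems \<A>"
  shows "admissible \<A> \<L>"
proof -
  obtain b where b: "\<And>L. L \<in> \<A> \<Longrightarrow> exp (2 * of_real pi * \<i> * b L) = \<L> L"
    "\<And>L. L \<in> \<A> \<Longrightarrow> 0 \<le> Re (b L) \<and> Re (b L) < 1" and int: "sum b \<A> \<in> \<int>"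
    using local_system_logarithm[OF fin \<L>] by blast
  define A where "A = \<A> - {L0}"
  have \<A>: "\<A> = insert L0 A" and A: "finite A" "L0 \<notin> A"
    using L0 fin by (auto simp: A_def)
  define a where "a = b(L0 := - sum b A)"
  have a_sum: "sum a X = sum b X" if "X \<subseteq> A" for X
    using that A by (intro sum.cong) (auto simp: a_def)
  have a_L0: "a L0 = - sum b A"
    by (simp add: a_def)
  show ?thesis
  proof (rule admissibleI[OF \<L>])
    fix L assume L: "L \<in> \<A>"
    have "a L0 - b L0 = - sum b \<A>"
      using A by (simp add: a_L0 \<A>)
    then have "a L0 - b L0 \<in> \<int>"
      using int by simp
    then have "a L - b L \<in> \<int>"
      by (cases "L = L0") (simp_all add: a_def)
    then show "exp (2 * of_real pi * \<i> * a L) = \<L> L"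
      using exp_2pi_ii_cong b(1)[OF L] by metis
    have "0 \<le> Re (sum b A)"
      using b(2) by (auto simp: \<A> intro!: sum_nonneg)
    then show "a L \<notin> pos_ints"
      using b(2)[OF L] by (intro Re_lt_1_imp_notin_pos_ints) (auto simp: a_def)
  next
    show "sum a \<A> = 0"
      using A by (simp add: \<A> a_L0 a_sum)
  next
    fix p assume "p \<in> \<Union>\<A>" "multiplicity_at \<A> p \<ge> 3"
    then have "p \<in> L0"
      by (rule cover)
    define X where "X = {L \<in> A. p \<in> L}"
    have "{L \<in> \<A>. p \<in> L} = insert L0 X"
      using \<open>p \<in> L0\<close> by (auto simp: \<A> X_def)
    moreover have X: "X \<subseteq> A" "finite X" "L0 \<notin> X"
      using A by (auto simp: X_def)
    ultimately have "residue_at \<A> a p = sum b X - sum b A"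
      by (simp add: residue_at_def a_L0 a_sum)
    moreover have "Re (sum b X) \<le> Re (sum b A)"
      using b(2) A X by (auto simp: \<A> intro!: sum_mono2)
    ultimately show "residue_at \<A> a p \<notin> pos_ints"
      by (intro Re_lt_1_imp_notin_pos_ints) simp
  qed
qed

lemma admissible_two_lines:
  assumes fin: "finite \<A>" and lines: "\<A> \<subseteq> proj_lines"
    and L0: "L0 \<in> \<A>" and L1: "L1 \<in> \<A>" and ne: "L0 \<noteq> L1"
    and cover: "\<And>p. p \<in> \<Union>\<A> \<Longrightarrow> multiplicity_at \<A> p \<ge> 3 \<Longrightarrow> p \<in> L0 \<or> p \<in> L1"
    and \<L>: "\<L> \<in> local_systems \<A>"
  shows "admissible \<A> \<L>"
proof -
  obtain b where b: "\<And>L. L \<in> \<A> \<Longrightarrow> exp (2 * of_real pi * \<i> * b L) = \<L> L"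
    "\<And>L. L \<in> \<A> \<Longrightarrow> 0 \<le> Re (b L) \<and> Re (b L) < 1" and int: "sum b \<A> \<in> \<int>"
    using local_system_logarithm[OF fin \<L>] by blast
  define A where "A = \<A> - {L0, L1}"
  have \<A>: "\<A> = insert L0 (insert L1 A)" and A: "finite A" "L0 \<notin> A" "L1 \<notin> A"
    using L0 L1 fin by (auto simp: A_def)
  have bA: "0 \<le> Re (b L) \<and> Re (b L) < 1" if "L \<in> A" for L
    using that b(2) by (auto simp: \<A>)
  define through where "through p = {L \<in> A. p \<in> L}" for p
  have through: "through p \<subseteq> A" "finite (through p)" "L0 \<notin> through p" "L1 \<notin> through p" for p
    using A by (auto simp: through_def)
  \<comment> \<open>The empty set encodes the condition on the residue of the line itself.\<close>
  define F where "F = insert {} (through ` (L0 - L1))"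
  define G where "G = insert {} (through ` (L1 - L0))"
  have card_FG: "card (X \<inter> Y) \<le> 1" if "X \<in> F" "Y \<in> G" for X Y
  proof (cases "X = {} \<or> Y = {}")
    case False
    then have "X \<in> through ` (L0 - L1)" "Y \<in> through ` (L1 - L0)"
      using that by (simp_all add: F_def G_def)
    then obtain p q where p: "p \<in> L0 - L1" "X = through p" and q: "q \<in> L1 - L0" "Y = through q"
      by blast
    \<comment> \<open>Both lines join \<open>p\<close> to \<open>q\<close>, which differ because
      \<open>p\<close> is not on \<open>L1\<close>.\<close>
    have "L = K" if "L \<in> X \<inter> Y" "K \<in> X \<inter> Y" for L K
      by (rule proj_lines_eqI[of L K p q]) (use that p q lines in \<open>auto simp: through_def \<A>\<close>)
    then show ?thesis
      using p(2) through(2) by (simp add: card_le_Suc0_iff_eq)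
  qed auto
  have int': "b L0 + b L1 + sum b A \<in> \<int>"
    using int A ne by (simp add: \<A> add.assoc)
  have FA: "X \<subseteq> A" if "X \<in> F" for X
    using that through(1) by (auto simp: F_def)
  have GA: "Y \<subseteq> A" if "Y \<in> G" for Y
    using that through(1) by (auto simp: G_def)
  obtain a0 a1 where a01: "a0 - b L0 \<in> \<int>" "a1 - b L1 \<in> \<int>" "a0 + a1 = - sum b A"
    "\<And>X. X \<in> F \<Longrightarrow> a0 + sum b X \<notin> pos_ints" "\<And>Y. Y \<in> G \<Longrightarrow> a1 + sum b Y \<notin> pos_ints"
    using exists_residue_pair[OF A(1) bA int' FA GA card_FG] by blast
  define a where "a = b(L0 := a0, L1 := a1)"
  have a_sum: "sum a X = sum b X" if "X \<subseteq> A" for X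
    using that A by (intro sum.cong) (auto simp: a_def)
  have a: "a L0 = a0" "a L1 = a1"
    using ne by (simp_all add: a_def)
  show ?thesis
  proof (rule admissibleI[OF \<L>])
    fix L assume L: "L \<in> \<A>"
    have "a L - b L \<in> \<int>"
      using a01 by (simp add: a_def)
    then show "exp (2 * of_real pi * \<i> * a L) = \<L> L"
      using exp_2pi_ii_cong b(1)[OF L] by metis
    have "a0 \<notin> pos_ints" "a1 \<notin> pos_ints"
      using a01(4)[of "{}"] a01(5)[of "{}"] by (auto simp: F_def G_def)
    then show "a L \<notin> pos_ints"
      using b(2)[OF L] by (auto simp: a_def Re_lt_1_imp_notin_pos_ints)
  next
    show "sum a \<A> = 0"
      using A ne a01(3) by (simp add: \<A> a a_sum flip: add.assoc)
  next
    fix p assume "p \<in> \<Union>\<A>" "multiplicity_at \<A> p \<ge> 3"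
    then have "p \<in> L0 \<or> p \<in> L1"
      by (rule cover)
    then consider "p \<in> L0 - L1" | "p \<in> L1 - L0" | "p \<in> L0 \<inter> L1"
      by blast
    then show "residue_at \<A> a p \<notin> pos_ints"
    proof cases
      case 1
      then have "{L \<in> \<A>. p \<in> L} = insert L0 (through p)"
        by (auto simp: \<A> through_def)
      then have "residue_at \<A> a p = a0 + sum b (through p)"
        using through by (simp add: residue_at_def a a_sum)
      then show ?thesis
        using a01(4) 1 by (simp add: F_def)
    next
      case 2
      then have "{L \<in> \<A>. p \<in> L} = insert L1 (through p)"
        by (auto simp: \<A> through_def)
      then have "residue_at \<A> a p = a1 + sum b (through p)"
        using through by (simp add: residue_at_def a a_sum)
      then show ?thesis
        using a01(5) 2 by (simp add: G_def)
    next
      case 3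
      then have "{L \<in> \<A>. p \<in> L} = insert L0 (insert L1 (through p))"
        by (auto simp: \<A> through_def)
      \<comment> \<open>Only the sum \<open>a0 + a1\<close> enters here, so the point needs no place
        in \<open>F\<close> or \<open>G\<close>.\<close>
      then have "residue_at \<A> a p = sum b (through p) - sum b A"
        using through ne a01(3) by (simp add: residue_at_def a a_sum flip: add.assoc)
      moreover have "Re (sum b (through p)) \<le> Re (sum b A)"
        using bA A through(1) by (auto intro!: sum_mono2)
      ultimately show ?thesis
        by (intro Re_lt_1_imp_notin_pos_ints) simp
    qed
  qed
qed

theorem theorem1p1:
  fixes \<A> :: "proj_point set set" and k :: nat
  assumes "line_arrangement \<A>"
    and "in_class_C k \<A>"
    and "k \<le> 2"
  shows "\<forall>\<L>\<in>local_systems \<A>. admissible \<A> \<L>"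
proof
  fix \<L> assume \<L>: "\<L> \<in> local_systems \<A>"
  have fin: "finite \<A>" and lines: "\<A> \<subseteq> proj_lines" and "\<A> \<noteq> {}"
    using assms(1) by (auto simp: line_arrangement_def)
  obtain \<B> where \<B>: "\<B> \<subseteq> \<A>" "card \<B> = k" "multiple_points \<A> \<subseteq> \<Union>\<B>"
    using assms(2) by (auto simp: in_class_C_def)
  have cover: "p \<in> \<Union>\<B>" if "p \<in> \<Union>\<A>" "multiplicity_at \<A> p \<ge> 3" for p
  proof -
    have "p \<in> P2"
      using that(1) lines by (auto simp: proj_lines_def zero_locus_def)
    then show ?thesis
      using that(2) \<B>(3) by (auto simp: multiple_points_def)
  qed
  have "finite \<B>"
    using \<B>(1) fin finite_subset by blast
  consider "k = 0" | "k = 1" | "k = 2"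
    using assms(3) by linarith
  then show "admissible \<A> \<L>"
  proof cases
    \<comment> \<open>There are no multiple points, so any line of \<A> can serve as
      \<open>L0\<close>.\<close>
    case 1
    then have "\<B> = {}"
      using \<B>(2) \<open>finite \<B>\<close> by simp
    moreover obtain L0 where "L0 \<in> \<A>"
      using \<open>\<A> \<noteq> {}\<close> by blast
    ultimately show ?thesis
      using admissible_one_line[OF fin _ _ \<L>, of L0] cover by blast
  next
    case 2
    then obtain L0 where "\<B> = {L0}"
      using \<B>(2) card_1_singletonE by metis
    then show ?thesis
      using admissible_one_line[OF fin _ _ \<L>, of L0] cover \<B>(1) by blast
  next
    case 3
    then obtain L0 L1 where "\<B> = {L0, L1}" "L0 \<noteq> L1"
      using \<B>(2) card_2_iff by metis
    then show ?thesis
      using admissible_two_lines[OF fin lines _ _ _ _ \<L>, of L0 L1] cover \<B>(1) by blast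
  qed
qed

end
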